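(* There is a (dynamic programming) algorithm that, given real numbers $0<a_1\le a_2\le\cdots\le a_n$, $0\le v_1\le v_2\le\cdots\le v_n$ and $b_1,\dots,b_n\ge0$, computes in time $O(n^2)$ the optimal value (and an optimal solution) of $$\max_{\mathbf z\in\mathbb{R}^n}\ \sum_{j=1}^n b_jz_j\cdot\mathbf{1}_{z_j\le v_j}$$ subject to $z_j/a_j\le z_i/a_i$ and $z_j\ge z_i$ for all $i,j$ with $a_j\ge a_i$, and $z_j\ge0$ for all $1\le j\le n$.
   Context: $\mathbf{1}_{z\le v}$ equals $1$ if $z\le v$ and $0$ otherwise. Running time counts arithmetic operations and comparisons on real numbers, each at unit cost. *)

theory Defs
  imports Complex_Main "HOL-Library.Landau_Symbols"
begin

section \<open>The optimization problem\<close>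

text \<open>Vectors in \<open>\<real>\<^sup>n\<close> are functions of type \<^typ>\<open>nat \<Rightarrow> real\<close> of which only the
  values at \<open>1, \<dots>, n\<close> matter.\<close>

definition valid_instance :: "nat \<Rightarrow> (nat \<Rightarrow> real) \<Rightarrow> (nat \<Rightarrow> real) \<Rightarrow> (nat \<Rightarrow> real) \<Rightarrow> bool" where
  "valid_instance n a v b \<longleftrightarrow>
     1 \<le> n \<and>
     (\<forall>j\<in>{1..n}. 0 < a j) \<and> mono_on {1..n} a \<and>
     (\<forall>j\<in>{1..n}. 0 \<le> v j) \<and> mono_on {1..n} v \<and>
     (\<forall>j\<in>{1..n}. 0 \<le> b j)"

definition feasible :: "nat \<Rightarrow> (nat \<Rightarrow> real) \<Rightarrow> (nat \<Rightarrow> real) \<Rightarrow> bool" where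
  "feasible n a z \<longleftrightarrow>
     (\<forall>i\<in>{1..n}. \<forall>j\<in>{1..n}. a j \<ge> a i \<longrightarrow> z j / a j \<le> z i / a i \<and> z j \<ge> z i) \<and>
     (\<forall>j\<in>{1..n}. z j \<ge> 0)"

definition objective ::
  "nat \<Rightarrow> (nat \<Rightarrow> real) \<Rightarrow> (nat \<Rightarrow> real) \<Rightarrow> (nat \<Rightarrow> real) \<Rightarrow> real" where
  "objective n v b z = (\<Sum>j = 1..n. b j * z j * of_bool (z j \<le> v j))"

section \<open>A real random access machine\<close>

text \<open>
  Algorithms are programs of a small imperative language over two disjoint kinds of arrays,
  natural-number valued and real valued, both indexed by natural numbers; a scalar variable is
  an array that is used at index \<open>0\<close> only.  A program is a finite syntactic object that names
  finitely many arrays and does not depend on the input size.  The only real constants are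
  integers, the only real operations are the four arithmetic operations, and real numbers
  influence the natural-number part and the control flow through comparisons only (there is no
  rounding and no conversion from reals to naturals).
\<close>

type_synonym vname = string

datatype iexp =
    IConst nat
  | IGet vname iexp
  | IAdd iexp iexp
  | ISub iexp iexp

datatype rexp =
    RConst int
  | RGet vname iexp
  | RAdd rexp rexp
  | RSub rexp rexp
  | RMul rexp rexp
  | RDiv rexp rexp

datatype bexp =
    ILess iexp iexp
  | IEq iexp iexp
  | RLess rexp rexp
  | RLe rexp rexp
  | BNot bexp
  | BAnd bexp bexp

datatype com =
    Skip
  | ISet vname iexp iexp
  | RSet vname iexp rexp
  | Seq com com
  | IfElse bexp com com
  | While bexp com

record state =
  iarr :: "vname \<Rightarrow> nat \<Rightarrow> nat"
  rarr :: "vname \<Rightarrow> nat \<Rightarrow> real"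

text \<open>Subtraction of naturals is truncated at \<open>0\<close>, and a real division by \<open>0\<close> yields \<open>0\<close>;
  the latter is a convention only, as a program can test the divisor beforehand.\<close>

fun ival :: "state \<Rightarrow> iexp \<Rightarrow> nat" where
  "ival s (IConst k) = k"
| "ival s (IGet x e) = iarr s x (ival s e)"
| "ival s (IAdd e f) = ival s e + ival s f"
| "ival s (ISub e f) = ival s e - ival s f"

fun rval :: "state \<Rightarrow> rexp \<Rightarrow> real" where
  "rval s (RConst k) = of_int k"
| "rval s (RGet x e) = rarr s x (ival s e)"
| "rval s (RAdd e f) = rval s e + rval s f"
| "rval s (RSub e f) = rval s e - rval s f"
| "rval s (RMul e f) = rval s e * rval s f"
| "rval s (RDiv e f) = rval s e / rval s f"

fun bval :: "state \<Rightarrow> bexp \<Rightarrow> bool" where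
  "bval s (ILess e f) \<longleftrightarrow> ival s e < ival s f"
| "bval s (IEq e f) \<longleftrightarrow> ival s e = ival s f"
| "bval s (RLess e f) \<longleftrightarrow> rval s e < rval s f"
| "bval s (RLe e f) \<longleftrightarrow> rval s e \<le> rval s f"
| "bval s (BNot c) \<longleftrightarrow> \<not> bval s c"
| "bval s (BAnd c d) \<longleftrightarrow> bval s c \<and> bval s d"

text \<open>
  Every arithmetic operation and comparison on reals costs one unit.  So that no work is free,
  every other primitive step (constants, array accesses, index arithmetic, index comparisons,
  Boolean connectives, assignments, tests) is charged one unit as well; the total is therefore
  an upper bound on the number of real operations and comparisons.
\<close>

fun icost :: "iexp \<Rightarrow> nat" where
  "icost (IConst k) = 1"
| "icost (IGet x e) = icost e + 1"
| "icost (IAdd e f) = icost e + icost f + 1"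
| "icost (ISub e f) = icost e + icost f + 1"

fun rcost :: "rexp \<Rightarrow> nat" where
  "rcost (RConst k) = 1"
| "rcost (RGet x e) = icost e + 1"
| "rcost (RAdd e f) = rcost e + rcost f + 1"
| "rcost (RSub e f) = rcost e + rcost f + 1"
| "rcost (RMul e f) = rcost e + rcost f + 1"
| "rcost (RDiv e f) = rcost e + rcost f + 1"

fun bcost :: "bexp \<Rightarrow> nat" where
  "bcost (ILess e f) = icost e + icost f + 1"
| "bcost (IEq e f) = icost e + icost f + 1"
| "bcost (RLess e f) = rcost e + rcost f + 1"
| "bcost (RLe e f) = rcost e + rcost f + 1"
| "bcost (BNot c) = bcost c + 1"
| "bcost (BAnd c d) = bcost c + bcost d + 1"

definition iupd :: "vname \<Rightarrow> nat \<Rightarrow> nat \<Rightarrow> state \<Rightarrow> state" where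
  "iupd x i k s = s\<lparr>iarr := (iarr s)(x := (iarr s x)(i := k))\<rparr>"

definition rupd :: "vname \<Rightarrow> nat \<Rightarrow> real \<Rightarrow> state \<Rightarrow> state" where
  "rupd x i r s = s\<lparr>rarr := (rarr s)(x := (rarr s x)(i := r))\<rparr>"

text \<open>\<open>exec c s t s'\<close>: started in state \<open>s\<close>, the program \<open>c\<close> terminates in state \<open>s'\<close> after
  \<open>t\<close> time units.\<close>

inductive exec :: "com \<Rightarrow> state \<Rightarrow> nat \<Rightarrow> state \<Rightarrow> bool" where
  Skip: "exec Skip s 1 s"
| ISet: "exec (ISet x e f) s (icost e + icost f + 1) (iupd x (ival s e) (ival s f) s)"
| RSet: "exec (RSet x e f) s (icost e + rcost f + 1) (rupd x (ival s e) (rval s f) s)"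
| Seq: "exec c s t s' \<Longrightarrow> exec d s' u s'' \<Longrightarrow> exec (Seq c d) s (t + u) s''"
| IfTrue: "bval s p \<Longrightarrow> exec c s t s' \<Longrightarrow> exec (IfElse p c d) s (bcost p + t + 1) s'"
| IfFalse: "\<not> bval s p \<Longrightarrow> exec d s t s' \<Longrightarrow> exec (IfElse p c d) s (bcost p + t + 1) s'"
| WhileFalse: "\<not> bval s p \<Longrightarrow> exec (While p c) s (bcost p + 1) s"
| WhileTrue: "bval s p \<Longrightarrow> exec c s t s' \<Longrightarrow> exec (While p c) s' u s'' \<Longrightarrow>
    exec (While p c) s (bcost p + t + u + 1) s''"

inductive_cases SkipE: "exec Skip s t s'"
inductive_cases ISetE: "exec (ISet x e f) s t s'"
inductive_cases RSetE: "exec (RSet x e f) s t s'"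
inductive_cases SeqE: "exec (Seq c d) s t s'"
inductive_cases IfE: "exec (IfElse p c d) s t s'"
inductive_cases WhileE: "exec (While p c) s t s'"

lemma exec_deterministic:
  "exec c s t s' \<Longrightarrow> exec c s u s'' \<Longrightarrow> u = t \<and> s'' = s'"
proof (induction arbitrary: u s'' rule: exec.induct)
  case (Skip s)
  from Skip show ?case by (rule SkipE) simp
next
  case (ISet x e f s)
  from ISet show ?case by (rule ISetE) simp
next
  case (RSet x e f s)
  from RSet show ?case by (rule RSetE) simp
next
  case (Seq c s t s' d w s3)
  from Seq.prems obtain t1 s1 u1
    where "u = t1 + u1" "exec c s t1 s1" "exec d s1 u1 s''"
    by (rule SeqE)
  with Seq.IH show ?case by metis
next
  case (IfTrue s p c t s' d)
  from IfTrue.prems IfTrue.hyps obtain t1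
    where "u = bcost p + t1 + 1" "exec c s t1 s''"
    by (elim IfE) simp_all
  with IfTrue.IH show ?case by metis
next
  case (IfFalse s p d t s' c)
  from IfFalse.prems IfFalse.hyps obtain t1
    where "u = bcost p + t1 + 1" "exec d s t1 s''"
    by (elim IfE) simp_all
  with IfFalse.IH show ?case by metis
next
  case (WhileFalse s p c)
  from WhileFalse.prems show ?case by (rule WhileE) (simp_all add: WhileFalse.hyps)
next
  case (WhileTrue s p c t s' w s3)
  from WhileTrue.prems obtain t1 s1 u1
    where "u = bcost p + t1 + u1 + 1" "exec c s t1 s1" "exec (While p c) s1 u1 s''"
    by (rule WhileE) (simp_all add: WhileTrue.hyps)
  with WhileTrue.IH show ?case by metis
qed

section \<open>Solving the problem on the machine\<close>

text \<open>The input occupies cell \<open>0\<close> of \<open>n\<close> and cells \<open>1, \<dots>, n\<close> of \<open>a\<close>, \<open>v\<close>, \<open>b\<close>; all other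
  memory is \<open>0\<close>.\<close>

definition init_state ::
  "nat \<Rightarrow> (nat \<Rightarrow> real) \<Rightarrow> (nat \<Rightarrow> real) \<Rightarrow> (nat \<Rightarrow> real) \<Rightarrow> state" where
  "init_state n a v b =
     \<lparr>iarr = (\<lambda>x i. if x = ''n'' \<and> i = 0 then n else 0),
      rarr = (\<lambda>x i. if i \<in> {1..n}
        then (if x = ''a'' then a i else if x = ''v'' then v i else if x = ''b'' then b i else 0)
        else 0)\<rparr>"

text \<open>On termination, cells \<open>1, \<dots>, n\<close> of \<open>z\<close> hold an optimal solution and cell \<open>0\<close> of \<open>opt\<close>
  holds the optimal value.\<close>

definition solved ::
  "nat \<Rightarrow> (nat \<Rightarrow> real) \<Rightarrow> (nat \<Rightarrow> real) \<Rightarrow> (nat \<Rightarrow> real) \<Rightarrow> state \<Rightarrow> bool" where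
  "solved n a v b s \<longleftrightarrow>
     is_arg_max (objective n v b) (feasible n a) (rarr s ''z'') \<and>
     rarr s ''opt'' 0 = objective n v b (rarr s ''z'')"

end

theory Submission
  imports Defs
begin

text \<open>
  If \<open>S\<close> is the set of counted indices \<open>j\<close> (those with \<open>z\<^sub>j \<le> v\<^sub>j\<close>), the constraints give
  \<open>z\<^sub>j \<le> a\<^sub>j r\<^sub>k\<close> for all \<open>k \<le> j\<close> in \<open>S\<close>, where \<open>r\<^sub>k = v\<^sub>k/a\<^sub>k\<close>, and since \<open>v\<close> is monotone these
  bounds are attained simultaneously on \<open>S\<close>.  So the problem is to choose \<open>S\<close> maximizing the sum of
  \<open>b\<^sub>j a\<^sub>j min {r\<^sub>k | k \<in> S, k \<le> j}\<close> over \<open>j \<in> S\<close>.  Only the strict records of \<open>r\<close> within \<open>S\<close> matter: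
  from a record \<open>k\<close> to the next record \<open>l\<close> it is best to count exactly the \<open>j\<close> with \<open>r\<^sub>j \<ge> r\<^sub>k\<close>.
  Hence the best value \<open>g k\<close> obtainable from index \<open>k\<close> on with \<open>k\<close> a record is the maximum of
  \<open>gain k l + g l\<close> over \<open>l > k\<close> with \<open>r\<^sub>l < r\<^sub>k\<close>, which is evaluated in time \<open>O(n)\<close> for each \<open>k\<close> with
  \<open>gain\<close> kept as a running sum.
\<close>

section \<open>The recurrence over records\<close>

text \<open>\<open>v\<^sub>l/a\<^sub>l < v\<^sub>k/a\<^sub>k\<close>, cross-multiplied so that the sentinel \<open>a\<^sub>0 = 0\<close> acts as ratio \<open>\<infinity>\<close>.\<close>
definition undercuts :: "(nat \<Rightarrow> real) \<Rightarrow> (nat \<Rightarrow> real) \<Rightarrow> nat \<Rightarrow> nat \<Rightarrow> bool" where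
  "undercuts a v k l \<longleftrightarrow> v l * a k < v k * a l"

text \<open>An index undercutting the current record \<open>k\<close> is left uncounted. For any
  other one the bound \<open>a j * v k / a k\<close> is at most \<open>v j\<close>, so it can be
  collected in full.\<close>

definition contrib ::
  "(nat \<Rightarrow> real) \<Rightarrow> (nat \<Rightarrow> real) \<Rightarrow> (nat \<Rightarrow> real) \<Rightarrow> nat \<Rightarrow> nat \<Rightarrow> real" where
  "contrib a v b k j = (if undercuts a v k j then 0 else b j * (a j * v k / a k))"

definition gain ::
  "(nat \<Rightarrow> real) \<Rightarrow> (nat \<Rightarrow> real) \<Rightarrow> (nat \<Rightarrow> real) \<Rightarrow> nat \<Rightarrow> nat \<Rightarrow> real" where
  "gain a v b k l = (\<Sum>j = k..<l. contrib a v b k j)"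

lemma gain_Suc: "k \<le> l \<Longrightarrow> gain a v b k (Suc l) = gain a v b k l + contrib a v b k l"
  by (simp add: gain_def)

lemma gain_same [simp]: "gain a v b k k = 0"
  by (simp add: gain_def)

lemma not_undercuts_self [simp]: "\<not> undercuts a v k k"
  by (simp add: undercuts_def)

text \<open>The last element up to \<open>j\<close> of the chain \<open>0\<close>,
  \<open>nxt 0\<close>, \<open>nxt (nxt 0)\<close>, ..., in the form in which a left-to-right scan
  maintains it.\<close>

primrec record_at :: "(nat \<Rightarrow> nat) \<Rightarrow> nat \<Rightarrow> nat" where
  "record_at nxt 0 = 0"
| "record_at nxt (Suc j) =
    (if Suc j = nxt (record_at nxt j) then Suc j else record_at nxt j)"

text \<open>Needed because the premise, used as a rewrite rule, turns \<open>Suc j\<close> into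
  \<open>nxt (record_at nxt j)\<close> and so hides the defining equation.\<close>

lemma record_at_next [simp]:
  "Suc j = nxt (record_at nxt j) \<Longrightarrow> record_at nxt (nxt (record_at nxt j)) = nxt (record_at nxt j)"
  by (metis record_at.simps(2))

text \<open>The vector \<open>min (a\<^sub>j v\<^sub>k/a\<^sub>k) (v\<^sub>l)\<close> for \<open>k \<le> j < l\<close> with \<open>k\<close>, \<open>l\<close> consecutive records; before the
  first record (\<open>k = 0\<close>) the test fails and the value is \<open>v\<^sub>l\<close>.\<close>
definition capped :: "(nat \<Rightarrow> real) \<Rightarrow> (nat \<Rightarrow> real) \<Rightarrow> (nat \<Rightarrow> nat) \<Rightarrow> nat \<Rightarrow> real" where
  "capped a u nxt j = (let k = record_at nxt j in
     if a j * u k < u (nxt k) * a k then a j * u k / a k else u (nxt k))"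

lemma feasibleI_consecutive:
  assumes pos: "\<And>j. j \<in> {1..n} \<Longrightarrow> 0 < a j" and mono: "mono_on {1..n} a"
    and nonneg: "\<And>j. j \<in> {1..n} \<Longrightarrow> 0 \<le> z j"
    and up: "\<And>j. 1 \<le> j \<Longrightarrow> j < n \<Longrightarrow> z j \<le> z (Suc j)"
    and down: "\<And>j. 1 \<le> j \<Longrightarrow> j < n \<Longrightarrow> z (Suc j) / a (Suc j) \<le> z j / a j"
  shows "feasible n a z"
proof -
  have chain: "z i \<le> z j \<and> z j / a j \<le> z i / a i" if "1 \<le> i" "i \<le> j" "j \<le> n" for i j
    using that(2,1,3)
  proof (induction j rule: dec_induct)
    case (step j)
    then show ?case using up[of j] down[of j] by auto
  qed simp
  show ?thesis
    unfolding feasible_def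
  proof (intro conjI ballI impI)
    fix i j assume ij: "i \<in> {1..n}" "j \<in> {1..n}" "a i \<le> a j"
    show "z j / a j \<le> z i / a i" "z i \<le> z j"
    proof (atomize (full), cases "i \<le> j")
      case False
      \<comment> \<open>Here \<open>j < i\<close>, so this is a tie in \<open>a\<close>; the chain
        from \<open>j\<close> to \<open>i\<close> then forces \<open>z i = z j\<close>.\<close>
      then have eq: "a i = a j"
        using mono ij by (simp add: mono_on_def order_antisym)
      have "z j \<le> z i \<and> z i / a i \<le> z j / a j"
        using chain[of j i] False ij by auto
      then show "z j / a j \<le> z i / a i \<and> z i \<le> z j"
        using pos[of j] ij eq by (auto simp: divide_simps split: if_splits)
    qed (use chain[of i j] ij in auto)
  qed (use nonneg in auto)
qed

text \<open>The sentinel at \<open>0\<close> stands for the ratio \<open>v\<^sub>0/a\<^sub>0 = \<infinity>\<close>, which everything undercuts, and the one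
  at \<open>n + 1\<close> for the ratio \<open>-1\<close>, which undercuts everything.\<close>

locale padded_instance =
  fixes n :: nat and a v b :: "nat \<Rightarrow> real"
  assumes valid: "valid_instance n a v b"
    and a_0: "a 0 = 0" and v_0: "v 0 = 1"
    and a_end: "a (Suc n) = 1" and v_end: "v (Suc n) = -1"
begin

abbreviation "und \<equiv> undercuts a v"
abbreviation "con \<equiv> contrib a v b"
abbreviation "gn \<equiv> gain a v b"

lemma a_pos: "1 \<le> j \<Longrightarrow> j \<le> n \<Longrightarrow> 0 < a j"
  and v_nonneg: "1 \<le> j \<Longrightarrow> j \<le> n \<Longrightarrow> 0 \<le> v j"
  and b_nonneg: "1 \<le> j \<Longrightarrow> j \<le> n \<Longrightarrow> 0 \<le> b j"
  and a_mono: "1 \<le> i \<Longrightarrow> i \<le> j \<Longrightarrow> j \<le> n \<Longrightarrow> a i \<le> a j"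
  and v_mono: "1 \<le> i \<Longrightarrow> i \<le> j \<Longrightarrow> j \<le> n \<Longrightarrow> v i \<le> v j"
  and n_pos: "1 \<le> n"
  using valid by (auto simp: valid_instance_def mono_on_def)

lemma und_end: "k \<le> n \<Longrightarrow> und k (Suc n)"
  using a_pos[of k] v_nonneg[of k]
  by (cases k) (auto simp: undercuts_def a_0 v_0 a_end v_end)

lemma und_0: "1 \<le> j \<Longrightarrow> j \<le> n \<Longrightarrow> und 0 j"
  using a_pos[of j] by (simp add: undercuts_def a_0 v_0)

text \<open>\<open>b 0\<close> is arbitrary, but \<open>a 0 = 0\<close> and division by zero giving
  zero make every contribution with \<open>j = 0\<close> or \<open>k = 0\<close> vanish.\<close>

lemma con_nonneg: "k \<le> n \<Longrightarrow> j \<le> n \<Longrightarrow> 0 \<le> con k j"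
  using a_pos[of j] a_pos[of k] v_nonneg[of k] b_nonneg[of j]
  by (cases k; cases j) (auto simp: contrib_def a_0)

lemma gn_nonneg: "k \<le> n \<Longrightarrow> l \<le> Suc n \<Longrightarrow> 0 \<le> gn k l"
  unfolding gain_def by (intro sum_nonneg con_nonneg) auto

text \<open>The Bellman equation of row \<open>k\<close>, with \<open>nxt k\<close> as a
  maximizer.\<close>

definition row_ok :: "(nat \<Rightarrow> real) \<Rightarrow> (nat \<Rightarrow> nat) \<Rightarrow> nat \<Rightarrow> bool" where
  "row_ok g nxt k \<longleftrightarrow>
     k < nxt k \<and> nxt k \<le> Suc n \<and> und k (nxt k) \<and> g k = gn k (nxt k) + g (nxt k) \<and>
     (\<forall>l. k < l \<longrightarrow> l \<le> Suc n \<longrightarrow> und k l \<longrightarrow> gn k l + g l \<le> g k)"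

text \<open>The value \<open>-1\<close> marks a row for which no candidate has been found yet.\<close>
definition row_partial :: "(nat \<Rightarrow> real) \<Rightarrow> (nat \<Rightarrow> nat) \<Rightarrow> nat \<Rightarrow> nat \<Rightarrow> bool" where
  "row_partial g nxt k m \<longleftrightarrow>
     (g k = -1 \<or>
      k < nxt k \<and> nxt k < m \<and> und k (nxt k) \<and> g k = gn k (nxt k) + g (nxt k)) \<and>
     (\<forall>l. k < l \<longrightarrow> l < m \<longrightarrow> und k l \<longrightarrow> gn k l + g l \<le> g k)"

text \<open>Row \<open>k'\<close> refers only to entries from \<open>k'\<close> on, so filling the
  table downwards never spoils a finished row.\<close>

lemma row_ok_upd:
  "row_ok g nxt k' \<Longrightarrow> k < k' \<Longrightarrow> row_ok (g(k := x)) (nxt(k := y)) k'"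
  by (auto simp: row_ok_def)

lemma row_partial_start: "g k = -1 \<Longrightarrow> row_partial g nxt k k"
  by (simp add: row_partial_def)

lemma row_partial_skip:
  "row_partial g nxt k m \<Longrightarrow> \<not> und k m \<or> gn k m + g m \<le> g k \<Longrightarrow> row_partial g nxt k (Suc m)"
  by (auto simp: row_partial_def less_Suc_eq)

lemma row_partial_improve:
  assumes "row_partial g nxt k m" "und k m" "g k < gn k m + g m" "k \<le> m"
  shows "row_partial (g(k := gn k m + g m)) (nxt(k := m)) k (Suc m)"
proof -
  \<comment> \<open>Strictness guarantees that overwriting row \<open>k\<close> leaves
    \<open>g m\<close> intact.\<close>
  have "k < m" using assms(2,4) by (cases "k = m") auto
  then show ?thesis using assms
    by (force simp: row_partial_def less_Suc_eq)
qed

text \<open>The final sentinel undercuts \<open>k\<close> and offers a nonnegative value, so the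
  mark \<open>-1\<close> cannot survive a complete scan.\<close>

lemma row_ok_if_partial:
  assumes "row_partial g nxt k (Suc (Suc n))" "k \<le> n" "g (Suc n) = 0"
  shows "row_ok g nxt k"
proof -
  have "gn k (Suc n) + g (Suc n) \<le> g k"
    using assms(1,2) und_end[of k] by (simp add: row_partial_def)
  then have "g k \<noteq> -1"
    using gn_nonneg[of k "Suc n"] assms by simp
  then show ?thesis
    using assms(1) by (auto simp: row_partial_def row_ok_def)
qed

end

section \<open>Upper bound: no feasible vector exceeds \<open>g 0\<close>\<close>

locale solved_table = padded_instance +
  fixes g :: "nat \<Rightarrow> real" and nxt :: "nat \<Rightarrow> nat"
  assumes rows: "\<And>k. k \<le> n \<Longrightarrow> row_ok g nxt k"
    and g_end: "g (Suc n) = 0"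
begin

text \<open>The next record after \<open>k\<close> is the first index \<open>l\<close> that is counted by the objective and undercuts
  \<open>k\<close>.  The counted indices \<open>j\<close> between them satisfy \<open>z\<^sub>j \<le> a\<^sub>j z\<^sub>k/a\<^sub>k \<le> a\<^sub>j v\<^sub>k/a\<^sub>k\<close>.\<close>

lemma objective_suffix_le:
  assumes feas: "feasible n a z" and k: "k \<le> Suc n"
    and counted: "k = 0 \<or> k = Suc n \<or> z k \<le> v k"
  shows "(\<Sum>j \<in> {k..n} - {0}. b j * z j * of_bool (z j \<le> v j)) \<le> g k"
  using k counted
proof (induction "Suc n - k" arbitrary: k rule: less_induct)
  case less
  show ?case
  proof (cases "k = Suc n")
    case True
    then show ?thesis by (simp add: g_end)
  next
    case False
    then have kn: "k \<le> n" using less.prems by simp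
    define P where "P l \<longleftrightarrow> k < l \<and> (l = Suc n \<or> z l \<le> v l) \<and> und k l" for l
    define l where "l = (LEAST l. P l)"
    have "P (Suc n)" using kn und_end[of k] by (simp add: P_def)
    then have Pl: "P l" and ln: "l \<le> Suc n"
      unfolding l_def by (auto intro: LeastI Least_le)
    have kl: "k < l" using Pl by (simp add: P_def)
    have not_P: "\<not> P j" if "j < l" for j
      using that unfolding l_def by (rule not_less_Least)
    have le_con: "b j * z j * of_bool (z j \<le> v j) \<le> con k j" if j: "j \<in> {k..<l} - {0}" for j
    proof (cases "z j \<le> v j")
      case False
      then show ?thesis using con_nonneg[of k j] kn j ln by auto
    next
      case True
      \<comment> \<open>Otherwise \<open>j\<close> would satisfy \<open>P\<close> before the least
        such index \<open>l\<close>.\<close>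
      have nu: "\<not> und k j"
        using not_P[of j] True j by (cases "j = k") (auto simp: P_def)
      \<comment> \<open>Every proper index undercuts the sentinel \<open>0\<close>, so nothing is
        counted before the first record.\<close>
      then have k0: "1 \<le> k" using und_0[of j] j ln by (cases k) auto
      have ak: "0 < a k" and aj: "0 < a j" and bj: "0 \<le> b j"
        using a_pos[of k] a_pos[of j] b_nonneg[of j] k0 kn j ln by auto
      have "z j / a j \<le> z k / a k"
        using feas k0 kn j ln a_mono[of k j] by (auto simp: feasible_def)
      also have "\<dots> \<le> v k / a k"
        using less.prems(2) k0 kn ak by (intro divide_right_mono) auto
      finally have "z j \<le> a j * v k / a k"
        using aj by (simp add: field_simps)
      then show ?thesis
        using nu True bj mult_left_mono[of "z j" "a j * v k / a k" "b j"]
        by (simp add: contrib_def)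
    qed
    have "(\<Sum>j \<in> {k..n} - {0}. b j * z j * of_bool (z j \<le> v j)) =
        (\<Sum>j \<in> ({k..<l} - {0}) \<union> ({l..n} - {0}). b j * z j * of_bool (z j \<le> v j))"
      using kl ln by (intro sum.cong) auto
    also have "\<dots> = (\<Sum>j \<in> {k..<l} - {0}. b j * z j * of_bool (z j \<le> v j)) +
        (\<Sum>j \<in> {l..n} - {0}. b j * z j * of_bool (z j \<le> v j))"
      by (intro sum.union_disjoint) auto
    also have "\<dots> \<le> (\<Sum>j \<in> {k..<l} - {0}. con k j) + g l"
      using less.hyps[of l] kl ln Pl by (intro add_mono sum_mono le_con) (auto simp: P_def)
    also have "(\<Sum>j \<in> {k..<l} - {0}. con k j) \<le> gn k l"
      unfolding gain_def using con_nonneg[OF kn] ln by (intro sum_mono2) auto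
    also have "gn k l + g l \<le> g k"
      using rows[OF kn] kl ln Pl by (auto simp: row_ok_def P_def)
    finally show ?thesis by simp
  qed
qed

lemma objective_le: "feasible n a z \<Longrightarrow> objective n v b z \<le> g 0"
proof -
  assume "feasible n a z"
  then have "(\<Sum>j \<in> {0..n} - {0}. b j * z j * of_bool (z j \<le> v j)) \<le> g 0"
    by (rule objective_suffix_le) auto
  moreover have "{0..n} - {0} = {1..n}" by auto
  ultimately show ?thesis by (simp add: objective_def)
qed

section \<open>Attainment: the vector read off from the table\<close>

abbreviation "rc \<equiv> record_at nxt"
text \<open>The sentinel ratio \<open>-1\<close> must not cap the vector after the last record; there \<open>v\<^sub>n\<close> is used.\<close>
abbreviation "u \<equiv> v(Suc n := v n)"

lemma rc_bounds: "j \<le> n \<Longrightarrow> rc j \<le> j \<and> j < nxt (rc j) \<and> nxt (rc j) \<le> Suc n"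
proof (induction j)
  case 0
  then show ?case using rows[of 0] by (auto simp: row_ok_def)
next
  case (Suc j)
  then show ?case using rows[of "Suc j"] by (auto simp: row_ok_def)
qed

text \<open>Telescoping along the records: passing from \<open>k\<close> to \<open>nxt k\<close>
  trades the completed \<open>gn k (nxt k)\<close> for \<open>g k - g (nxt k)\<close>.\<close>

lemma sum_con_rc:
  "j \<le> n \<Longrightarrow> (\<Sum>i\<le>j. con (rc i) i) = g 0 - g (rc j) + gn (rc j) (Suc j)"
proof (induction j)
  case 0
  then show ?case by (simp add: gain_def)
next
  case (Suc j)
  note bounds = rc_bounds[of j]
  show ?case
  proof (cases "Suc j = nxt (rc j)")
    case True
    have "g (rc j) = gn (rc j) (Suc j) + g (Suc j)"
      using rows[of "rc j"] bounds Suc.prems True by (auto simp: row_ok_def)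
    moreover have rc': "rc (Suc j) = Suc j" using True by simp
    ultimately show ?thesis
      using Suc by (simp add: gain_Suc del: record_at.simps)
  next
    case False
    then show ?thesis using Suc bounds by (simp add: gain_Suc)
  qed
qed

lemma u_mono: "1 \<le> i \<Longrightarrow> i \<le> j \<Longrightarrow> j \<le> Suc n \<Longrightarrow> u i \<le> u j"
  using v_mono[of i j] v_mono[of i n] by auto

lemma u_nonneg: "1 \<le> j \<Longrightarrow> j \<le> Suc n \<Longrightarrow> 0 \<le> u j"
  using v_nonneg n_pos by auto

lemma capped_eq_min:
  assumes "j \<le> n" "rc j \<noteq> 0"
  shows "capped a u nxt j = min (a j * v (rc j) / a (rc j)) (u (nxt (rc j)))"
proof -
  have "rc j \<le> n" "0 < a (rc j)"
    using rc_bounds[of j] a_pos[of "rc j"] assms by auto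
  then show ?thesis
    by (auto simp: capped_def Let_def min_def field_simps)
qed

lemma capped_eq_cap:
  assumes "1 \<le> j" "j \<le> n" "rc j = 0"
  shows "capped a u nxt j = u (nxt 0)"
  using assms a_pos[of j] by (simp add: capped_def Let_def a_0 v_0)

lemma capped_at_record:
  assumes "1 \<le> j" "j \<le> n" "rc j = j"
  shows "capped a u nxt j = v j"
  using assms capped_eq_min[of j] a_pos[of j] u_mono[of j "nxt j"] rc_bounds[of j]
  by (auto simp: min_def)

text \<open>The cap is inactive here: the ratio bound is at most \<open>v j\<close>, which is at
  most the cap because \<open>v\<close> is monotone.\<close>

lemma capped_eq_if_con:
  assumes "1 \<le> j" "j \<le> n" "\<not> und (rc j) j"
  shows "capped a u nxt j = a j * v (rc j) / a (rc j) \<and> capped a u nxt j \<le> v j"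
proof -
  have k: "1 \<le> rc j" using und_0[of j] assms by (cases "rc j") auto
  have ak: "0 < a (rc j)" using a_pos[of "rc j"] k rc_bounds[of j] assms by auto
  have le: "a j * v (rc j) / a (rc j) \<le> v j"
    using assms(3) ak by (simp add: undercuts_def field_simps)
  also have "v j \<le> u (nxt (rc j))"
    using u_mono[of j "nxt (rc j)"] rc_bounds[of j] assms by auto
  finally show ?thesis using le capped_eq_min[of j] k assms by simp
qed

lemma capped_nonneg: "1 \<le> j \<Longrightarrow> j \<le> n \<Longrightarrow> 0 \<le> capped a u nxt j"
  using capped_eq_cap[of j] capped_eq_min[of j] rc_bounds[of j] u_nonneg[of "nxt (rc j)"]
    a_pos[of j] a_pos[of "rc j"] v_nonneg[of "rc j"]
  by (cases "rc j = 0") auto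

lemma capped_le_cap: "1 \<le> j \<Longrightarrow> j \<le> n \<Longrightarrow> capped a u nxt j \<le> u (nxt (rc j))"
  using capped_eq_cap[of j] capped_eq_min[of j] by (cases "rc j = 0") auto

text \<open>Within a segment the vector is a minimum of a multiple of \<open>a\<close> and a
  constant, or just a constant. On entering a new record the value becomes the old cap; the ratio
  does not rise, by undercutting if the ratio bound was active and by monotonicity of
  \<open>a\<close> otherwise.\<close>

lemma capped_step:
  assumes j: "1 \<le> j" "j < n"
  shows "capped a u nxt j \<le> capped a u nxt (Suc j)"
    and "capped a u nxt (Suc j) / a (Suc j) \<le> capped a u nxt j / a j"
proof -
  let ?z = "capped a u nxt" and ?k = "rc j"
  have bounds: "?k \<le> j" "j < nxt ?k" "nxt ?k \<le> Suc n" using rc_bounds[of j] j by auto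
  have aj: "0 < a j" and aj': "0 < a (Suc j)" and amono: "a j \<le> a (Suc j)"
    using a_pos[of j] a_pos[of "Suc j"] a_mono[of j "Suc j"] j by auto
  have cap: "0 \<le> u (nxt ?k)" using u_nonneg[of "nxt ?k"] bounds j by simp
  have "?z j \<le> ?z (Suc j) \<and> ?z (Suc j) * a j \<le> ?z j * a (Suc j)"
  proof (cases "Suc j = nxt ?k")
    case True
    then have z': "?z (Suc j) = v (Suc j)"
      using capped_at_record[of "Suc j"] j True by auto
    have cv: "u (nxt ?k) = v (Suc j)" using True[symmetric] j by simp
    have v': "0 \<le> v (Suc j)" using v_nonneg[of "Suc j"] j by simp
    have up: "?z j \<le> v (Suc j)" using capped_le_cap[of j] j cv by simp
    have flat: "v (Suc j) * a j \<le> v (Suc j) * a (Suc j)"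
      using v' amono by (intro mult_left_mono)
    have "v (Suc j) * a j \<le> ?z j * a (Suc j)"
    proof (cases "?k = 0")
      case True
      then show ?thesis using capped_eq_cap[of j] flat cv j by simp
    next
      case False
      then have ak: "0 < a ?k" using a_pos[of ?k] bounds j by auto
      have "v (Suc j) * a ?k < v ?k * a (Suc j)"
        using rows[of ?k] bounds j True by (auto simp: row_ok_def undercuts_def)
      then have "a j * (v (Suc j) * a ?k) \<le> a j * (v ?k * a (Suc j))"
        using aj by (intro mult_left_mono) auto
      then have "v (Suc j) * a j \<le> a j * v ?k / a ?k * a (Suc j)"
        using ak by (simp add: field_simps)
      then show ?thesis
        using capped_eq_min[of j] False j cv flat by (auto simp: min_def)
    qed
    then show ?thesis using up z' by simp
  next
    case False
    then have rc': "rc (Suc j) = ?k" by simp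
    show ?thesis
    proof (cases "?k = 0")
      case True
      then show ?thesis
        using capped_eq_cap[of j] capped_eq_cap[of "Suc j"] rc' j cap amono
        by (simp add: mult_left_mono)
    next
      case False
      define c where "c = v ?k / a ?k"
      have c: "0 \<le> c"
        using False a_pos[of ?k] v_nonneg[of ?k] bounds j by (simp add: c_def)
      have z: "?z j = min (a j * c) (u (nxt ?k))" "?z (Suc j) = min (a (Suc j) * c) (u (nxt ?k))"
        using capped_eq_min[of j] capped_eq_min[of "Suc j"] False rc' j by (simp_all add: c_def)
      have "a j * c \<le> a (Suc j) * c" using amono c by (intro mult_right_mono)
      moreover have "min (a (Suc j) * c) (u (nxt ?k)) * a j \<le> min (a j * c) (u (nxt ?k)) * a (Suc j)"
      proof (cases "a j * c \<le> u (nxt ?k)")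
        case True
        have "min (a (Suc j) * c) (u (nxt ?k)) * a j \<le> (a (Suc j) * c) * a j"
          using aj by (intro mult_right_mono) auto
        also have "\<dots> = min (a j * c) (u (nxt ?k)) * a (Suc j)"
          using True by (simp add: min_def)
        finally show ?thesis .
      next
        case False
        have "min (a (Suc j) * c) (u (nxt ?k)) * a j \<le> u (nxt ?k) * a (Suc j)"
          using aj amono cap by (intro mult_mono) auto
        then show ?thesis using False by (simp add: min_def)
      qed
      ultimately show ?thesis unfolding z by auto
    qed
  qed
  then show "?z j \<le> ?z (Suc j)" "?z (Suc j) / a (Suc j) \<le> ?z j / a j"
    using aj aj' by (simp_all add: field_simps)
qed

lemma feasible_capped: "feasible n a (capped a u nxt)"
proof (rule feasibleI_consecutive)
  show "mono_on {1..n} a" using valid by (simp add: valid_instance_def)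
qed (use a_pos capped_nonneg capped_step in auto)

lemma objective_capped_ge: "g 0 \<le> objective n v b (capped a u nxt)"
proof -
  let ?z = "capped a u nxt"
  have "rc n \<le> n" "nxt (rc n) = Suc n" using rc_bounds[of n] by auto
  then have "g (rc n) = gn (rc n) (Suc n)"
    using rows[of "rc n"] g_end by (simp add: row_ok_def)
  then have "g 0 = (\<Sum>i\<le>n. con (rc i) i)"
    using sum_con_rc[of n] by simp
  also have "\<dots> = (\<Sum>i = 1..n. con (rc i) i)"
  proof (rule sum.mono_neutral_right)
    show "\<forall>i\<in>{..n} - {1..n}. con (rc i) i = 0" by (auto simp: contrib_def a_0 not_less_eq_eq)
  qed auto
  \<comment> \<open>Only an inequality: an index undercutting its record has \<open>con\<close>
    zero, yet its value may still lie below \<open>v i\<close> and add a nonnegative term.\<close>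
  also have "\<dots> \<le> (\<Sum>i = 1..n. b i * ?z i * of_bool (?z i \<le> v i))"
  proof (rule sum_mono)
    fix i assume i: "i \<in> {1..n}"
    show "con (rc i) i \<le> b i * ?z i * of_bool (?z i \<le> v i)"
      using capped_eq_if_con[of i] i b_nonneg[of i] capped_nonneg[of i]
      by (cases "und (rc i) i") (auto simp: contrib_def)
  qed
  finally show ?thesis by (simp add: objective_def)
qed

lemma optimal_if_capped:
  assumes z: "\<And>j. j \<in> {1..n} \<Longrightarrow> z j = capped a u nxt j"
  shows "is_arg_max (objective n v b) (feasible n a) z \<and> g 0 = objective n v b z"
proof -
  have obj: "objective n v b z = objective n v b (capped a u nxt)"
    unfolding objective_def using z by (intro sum.cong) auto
  have feas: "feasible n a z"
    using feasible_capped z by (simp add: feasible_def)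
  have "objective n v b z = g 0"
    using objective_le[OF feas] objective_capped_ge obj by simp
  then show ?thesis
    using feas objective_le by (force simp: is_arg_max_def not_less)
qed

end

section \<open>Running time bounds\<close>

definition runs :: "com \<Rightarrow> state \<Rightarrow> nat \<Rightarrow> (state \<Rightarrow> bool) \<Rightarrow> bool" where
  "runs c s B Q \<longleftrightarrow> (\<exists>t s'. exec c s t s' \<and> t \<le> B \<and> Q s')"

lemma runs_mono: "runs c s B Q \<Longrightarrow> B \<le> B' \<Longrightarrow> (\<And>s'. Q s' \<Longrightarrow> Q' s') \<Longrightarrow> runs c s B' Q'"
  unfolding runs_def by (meson order_trans)

lemma runs_Seq:
  assumes "runs c s B P" "\<And>s'. P s' \<Longrightarrow> runs d s' C Q"
  shows "runs (Seq c d) s (B + C) Q"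
  using assms unfolding runs_def by (meson exec.Seq add_mono)

fun loop_free :: "com \<Rightarrow> bool" where
  "loop_free (Seq c d) \<longleftrightarrow> loop_free c \<and> loop_free d"
| "loop_free (IfElse p c d) \<longleftrightarrow> loop_free c \<and> loop_free d"
| "loop_free (While p c) \<longleftrightarrow> False"
| "loop_free _ \<longleftrightarrow> True"

text \<open>Symbolic execution by simplification; the value on \<open>While\<close> is a dummy,
  excluded by \<open>loop_free\<close>.\<close>

fun outcome :: "com \<Rightarrow> state \<Rightarrow> state" where
  "outcome (ISet x e f) s = iupd x (ival s e) (ival s f) s"
| "outcome (RSet x e f) s = rupd x (ival s e) (rval s f) s"
| "outcome (Seq c d) s = outcome d (outcome c s)"
| "outcome (IfElse p c d) s = (if bval s p then outcome c s else outcome d s)"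
| "outcome _ s = s"

text \<open>Adding both branches of a conditional gives a bound independent of the state.\<close>

fun ccost :: "com \<Rightarrow> nat" where
  "ccost (ISet x e f) = icost e + icost f + 1"
| "ccost (RSet x e f) = icost e + rcost f + 1"
| "ccost (Seq c d) = ccost c + ccost d"
| "ccost (IfElse p c d) = bcost p + ccost c + ccost d + 1"
| "ccost _ = 1"

lemma exec_loop_free: "loop_free c \<Longrightarrow> \<exists>t \<le> ccost c. exec c s t (outcome c s)"
proof (induction c arbitrary: s)
  case (Seq c d)
  then obtain t u where "t \<le> ccost c" "exec c s t (outcome c s)"
    "u \<le> ccost d" "exec d (outcome c s) u (outcome d (outcome c s))"
    by fastforce
  then show ?case by (intro exI[of _ "t + u"]) (auto intro: exec.Seq)
next
  case (IfElse p c d)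
  show ?case
  proof (cases "bval s p")
    case True
    then obtain t where "t \<le> ccost c" "exec c s t (outcome c s)" using IfElse by fastforce
    then show ?thesis using True
      by (intro exI[of _ "bcost p + t + 1"]) (auto intro: exec.IfTrue[simplified])
  next
    case False
    then obtain t where "t \<le> ccost d" "exec d s t (outcome d s)" using IfElse by fastforce
    then show ?thesis using False
      by (intro exI[of _ "bcost p + t + 1"]) (auto intro: exec.IfFalse[simplified])
  qed
qed (auto intro: exec.Skip[simplified] exec.ISet[simplified] exec.RSet[simplified])

lemma runs_loop_free: "loop_free c \<Longrightarrow> Q (outcome c s) \<Longrightarrow> runs c s (ccost c) Q"
  unfolding runs_def using exec_loop_free by blast

text \<open>\<open>I\<close> is indexed by the number of completed rounds; the last summand pays for
  the final, failing test.\<close>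

lemma runs_While:
  assumes step: "\<And>i s. i < N \<Longrightarrow> I i s \<Longrightarrow> bval s p \<and> runs c s B (I (Suc i))"
    and stop: "\<And>s. I N s \<Longrightarrow> \<not> bval s p"
    and start: "I 0 s"
  shows "runs (While p c) s (N * (bcost p + B + 1) + (bcost p + 1)) (I N)"
proof -
  have "runs (While p c) s ((N - i) * (bcost p + B + 1) + (bcost p + 1)) (I N)"
    if "i \<le> N" "I i s" for i s
    using that
  proof (induction i arbitrary: s rule: inc_induct)
    case base
    then show ?case
      unfolding runs_def using exec.WhileFalse[OF stop[of s], of c] by auto
  next
    case (step i)
    from assms(1)[OF step.hyps(2) step.prems] obtain t s'
      where p: "bval s p" and t: "exec c s t s'" "t \<le> B" and s': "I (Suc i) s'"
      by (auto simp: runs_def)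
    from step.IH[OF s'] obtain w s''
      where w: "exec (While p c) s' w s''" "w \<le> (N - Suc i) * (bcost p + B + 1) + (bcost p + 1)"
        "I N s''"
      by (auto simp: runs_def)
    have "bcost p + t + w + 1 \<le> (N - i) * (bcost p + B + 1) + (bcost p + 1)"
      using t(2) w(2) step.hyps by (simp add: Suc_diff_Suc[symmetric])
    then show ?case
      unfolding runs_def using exec.WhileTrue[OF p t(1) w(1)] w(3) by blast
  qed
  from this[of 0] start show ?thesis by simp
qed

section \<open>The program\<close>

abbreviation IV :: "vname \<Rightarrow> iexp" where "IV x \<equiv> IGet x (IConst 0)"
abbreviation IPut :: "vname \<Rightarrow> iexp \<Rightarrow> com" where "IPut x \<equiv> ISet x (IConst 0)"
abbreviation IInc :: "iexp \<Rightarrow> iexp" where "IInc e \<equiv> IAdd e (IConst 1)"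

text \<open>The remaining sentinel values, \<open>0\<close> in \<open>a\<close> at \<open>0\<close>
  and in \<open>opt\<close> at \<open>n + 1\<close>, come from the zeroed memory.\<close>

definition pad :: com where
  "pad =
     Seq (RSet ''v'' (IConst 0) (RConst 1))
    (Seq (RSet ''a'' (IInc (IV ''n'')) (RConst 1))
    (Seq (RSet ''v'' (IInc (IV ''n'')) (RConst (-1)))
         (IPut ''i'' (IConst 0))))"

text \<open>\<open>opt\<close> stores the table \<open>g\<close> and \<open>acc\<close> the running
  gain. The scan starts at \<open>l = k\<close>, which does not undercut itself, so the first round
  adds the contribution of \<open>k\<close> to \<open>acc\<close>.\<close>

definition start_row :: com where
  "start_row =
     Seq (IPut ''k'' (ISub (IV ''n'') (IV ''i'')))
    (Seq (IPut ''l'' (IV ''k''))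
    (Seq (RSet ''acc'' (IConst 0) (RConst 0))
         (RSet ''opt'' (IV ''k'') (RConst (-1)))))"

definition row_test :: bexp where
  "row_test = ILess (IV ''l'') (IInc (IInc (IV ''n'')))"

definition row_step :: com where
  "row_step =
     Seq (IfElse (RLess (RMul (RGet ''v'' (IV ''l'')) (RGet ''a'' (IV ''k'')))
                        (RMul (RGet ''v'' (IV ''k'')) (RGet ''a'' (IV ''l''))))
           (IfElse (RLess (RGet ''opt'' (IV ''k''))
                          (RAdd (RGet ''acc'' (IConst 0)) (RGet ''opt'' (IV ''l''))))
             (Seq (RSet ''opt'' (IV ''k'')
                    (RAdd (RGet ''acc'' (IConst 0)) (RGet ''opt'' (IV ''l''))))
                  (ISet ''nxt'' (IV ''k'') (IV ''l'')))
             Skip)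
           (RSet ''acc'' (IConst 0)
             (RAdd (RGet ''acc'' (IConst 0))
               (RMul (RGet ''b'' (IV ''l''))
                 (RDiv (RMul (RGet ''a'' (IV ''l'')) (RGet ''v'' (IV ''k'')))
                   (RGet ''a'' (IV ''k'')))))))
         (IPut ''l'' (IInc (IV ''l'')))"

definition next_row :: com where
  "next_row = IPut ''i'' (IInc (IV ''i''))"

definition table_test :: bexp where
  "table_test = ILess (IV ''i'') (IInc (IV ''n''))"

definition table_step :: com where
  "table_step = Seq start_row (Seq (While row_test row_step) next_row)"

definition start_output :: com where
  "start_output =
     Seq (RSet ''v'' (IInc (IV ''n'')) (RGet ''v'' (IV ''n'')))
    (Seq (IPut ''k'' (IConst 0)) (IPut ''j'' (IConst 1)))"

definition output_test :: bexp where
  "output_test = ILess (IV ''j'') (IInc (IV ''n''))"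

definition output_step :: com where
  "output_step =
     Seq (IfElse (IEq (IV ''j'') (IGet ''nxt'' (IV ''k''))) (IPut ''k'' (IV ''j'')) Skip)
    (Seq (IfElse (RLess (RMul (RGet ''a'' (IV ''j'')) (RGet ''v'' (IV ''k'')))
                        (RMul (RGet ''v'' (IGet ''nxt'' (IV ''k''))) (RGet ''a'' (IV ''k''))))
           (RSet ''z'' (IV ''j'')
             (RDiv (RMul (RGet ''a'' (IV ''j'')) (RGet ''v'' (IV ''k''))) (RGet ''a'' (IV ''k''))))
           (RSet ''z'' (IV ''j'') (RGet ''v'' (IGet ''nxt'' (IV ''k'')))))
         (IPut ''j'' (IInc (IV ''j''))))"

definition program :: com where
  "program =
     Seq pad (Seq (While table_test table_step)
       (Seq start_output (While output_test output_step)))"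

definition row_time :: "nat \<Rightarrow> nat" where
  "row_time n = ccost start_row +
     (Suc (Suc n) * (bcost row_test + ccost row_step + 1) + (bcost row_test + 1) + ccost next_row)"

definition program_time :: "nat \<Rightarrow> nat" where
  "program_time n = ccost pad +
     (Suc n * (bcost table_test + row_time n + 1) + (bcost table_test + 1) +
      (ccost start_output +
       (n * (bcost output_test + ccost output_step + 1) + (bcost output_test + 1))))"

lemmas state_simps = iupd_def rupd_def

lemma program_time_le: "\<exists>C. \<forall>n\<ge>1. program_time n \<le> C * n\<^sup>2"
proof -
  define c where "c = bcost row_test + ccost row_step + 1"
  define d where "d = ccost start_row + bcost row_test + 1 + ccost next_row + bcost table_test + 1"
  define e where "e = bcost output_test + ccost output_step + 1"
  define f where "f = ccost pad + bcost table_test + 1 + ccost start_output + bcost output_test + 1"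
  have "program_time n \<le> (6 * c + 2 * d + e + f) * n\<^sup>2" if n: "1 \<le> n" for n
  proof -
    have "program_time n = Suc n * (Suc (Suc n) * c + d) + n * e + f"
      by (simp add: program_time_def row_time_def c_def d_def e_def f_def algebra_simps)
    \<comment> \<open>For \<open>n >= 1\<close>, \<open>Suc n\<close> is at most
      \<open>2 * n\<close> and \<open>Suc (Suc n)\<close> at most \<open>3 * n\<close>; lower-order
      terms are padded with factors \<open>n\<close>.\<close>
    also have "\<dots> \<le> (2 * n) * ((3 * n) * c + n * d) + n * (n * e) + (n * n) * f"
      using n by (intro add_mono mult_mono) auto
    also have "\<dots> = (6 * c + 2 * d + e + f) * n\<^sup>2"
      by (simp add: power2_eq_square algebra_simps)
    finally show ?thesis .
  qed
  then show ?thesis by blast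
qed

section \<open>Loop invariants and correctness of the program\<close>

context padded_instance
begin

definition has_input :: "(nat \<Rightarrow> real) \<Rightarrow> state \<Rightarrow> bool" where
  "has_input w s \<longleftrightarrow>
     iarr s ''n'' 0 = n \<and> rarr s ''a'' = a \<and> rarr s ''v'' = w \<and> rarr s ''b'' = b"

text \<open>The last \<open>i\<close> rows are finished. Truncated subtraction in the form
  \<open>n - i < k\<close> would lose row \<open>0\<close> at \<open>i = Suc n\<close>.\<close>

definition table_inv :: "nat \<Rightarrow> state \<Rightarrow> bool" where
  "table_inv i s \<longleftrightarrow> has_input v s \<and> iarr s ''i'' 0 = i \<and> rarr s ''opt'' (Suc n) = 0 \<and>
     (\<forall>k. n < k + i \<longrightarrow> k \<le> n \<longrightarrow> row_ok (rarr s ''opt'') (iarr s ''nxt'') k)"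

definition row_inv :: "nat \<Rightarrow> nat \<Rightarrow> state \<Rightarrow> bool" where
  "row_inv k m s \<longleftrightarrow> has_input v s \<and> iarr s ''i'' 0 = n - k \<and> rarr s ''opt'' (Suc n) = 0 \<and>
     (\<forall>k'. k < k' \<longrightarrow> k' \<le> n \<longrightarrow> row_ok (rarr s ''opt'') (iarr s ''nxt'') k') \<and>
     iarr s ''k'' 0 = k \<and> iarr s ''l'' 0 = k + m \<and> rarr s ''acc'' 0 = gn k (k + m) \<and>
     row_partial (rarr s ''opt'') (iarr s ''nxt'') k (k + m)"

lemma row_inv_step:
  assumes inv: "row_inv k m s" and m: "k + m \<le> Suc n" and k: "k \<le> n"
  shows "row_inv k (Suc m) (outcome row_step s)"
proof -
  let ?l = "k + m" and ?g = "rarr s ''opt''" and ?nxt = "iarr s ''nxt''"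
  have state: "iarr s ''n'' 0 = n" "rarr s ''a'' = a" "rarr s ''v'' = v" "rarr s ''b'' = b"
    "iarr s ''k'' 0 = k" "iarr s ''l'' 0 = ?l" "rarr s ''acc'' 0 = gn k ?l"
    "iarr s ''i'' 0 = n - k" "?g (Suc n) = 0"
    and above: "\<And>k'. k < k' \<Longrightarrow> k' \<le> n \<Longrightarrow> row_ok ?g ?nxt k'"
    and part: "row_partial ?g ?nxt k ?l"
    using inv by (auto simp: row_inv_def has_input_def)
  \<comment> \<open>These are the branches of \<open>row_step\<close>. In the last two
    \<open>acc\<close> is unchanged, in accordance with \<open>con k (k + m) = 0\<close>.\<close>
  consider (skip) "\<not> und k ?l" | (keep) "und k ?l" "\<not> ?g k < gn k ?l + ?g ?l"
    | (improve) "und k ?l" "?g k < gn k ?l + ?g ?l"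
    by blast
  then show ?thesis
  proof cases
    case skip
    then show ?thesis
      using row_partial_skip[OF part] above state k
      by (auto simp: row_inv_def has_input_def row_step_def state_simps undercuts_def
          contrib_def gain_Suc)
  next
    case keep
    then show ?thesis
      using row_partial_skip[OF part] above state k
      by (auto simp: row_inv_def has_input_def row_step_def state_simps undercuts_def
          contrib_def gain_Suc)
  next
    case improve
    have "row_partial (?g(k := gn k ?l + ?g ?l)) (?nxt(k := ?l)) k (Suc ?l)"
      by (rule row_partial_improve[OF part improve]) simp
    then show ?thesis
      using row_ok_upd[OF above] improve state k
      by (auto simp: row_inv_def has_input_def row_step_def state_simps undercuts_def
          contrib_def gain_Suc)
  qed
qed

text \<open>The exact count of \<open>n + 2 - k\<close> rounds is relaxed to \<open>n + 2\<close>,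
  making the bound uniform in the row.\<close>

lemma runs_row:
  assumes k: "k \<le> n" and inv: "row_inv k 0 s"
  shows "runs (While row_test row_step) s
    (Suc (Suc n) * (bcost row_test + ccost row_step + 1) + (bcost row_test + 1))
    (row_inv k (Suc (Suc n) - k))"
proof (rule runs_mono)
  show "runs (While row_test row_step) s
    ((Suc (Suc n) - k) * (bcost row_test + ccost row_step + 1) + (bcost row_test + 1))
    (row_inv k (Suc (Suc n) - k))"
  proof (rule runs_While)
    fix m s assume m: "m < Suc (Suc n) - k" and s: "row_inv k m s"
    have "bval s row_test"
      using m s by (auto simp: row_test_def row_inv_def has_input_def)
    moreover have "runs row_step s (ccost row_step) (row_inv k (Suc m))"
      using row_inv_step[OF s _ k] m by (intro runs_loop_free) (auto simp: row_step_def)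
    ultimately show "bval s row_test \<and> runs row_step s (ccost row_step) (row_inv k (Suc m))" ..
  next
    fix s assume "row_inv k (Suc (Suc n) - k) s"
    then show "\<not> bval s row_test"
      using k by (auto simp: row_test_def row_inv_def has_input_def)
  qed (rule inv)
qed (auto intro!: add_mono mult_mono simp del: mult_Suc mult_Suc_right)

lemma runs_table_step:
  assumes i: "i < Suc n" and inv: "table_inv i s"
  shows "runs table_step s (row_time n) (table_inv (Suc i))"
  unfolding table_step_def row_time_def
proof (rule runs_Seq)
  show "runs start_row s (ccost start_row) (row_inv (n - i) 0)"
  proof (rule runs_loop_free)
    have above: "row_ok (rarr s ''opt'') (iarr s ''nxt'') k'" if "n - i < k'" "k' \<le> n" for k'
      using inv that by (auto simp: table_inv_def)
    have part: "row_partial ((rarr s ''opt'')(n - i := -1)) (iarr s ''nxt'') (n - i) (n - i)"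
      by (simp add: row_partial_start)
    show "row_inv (n - i) 0 (outcome start_row s)"
      using inv i part row_ok_upd[OF above, of _ "n - i" "-1" "iarr s ''nxt'' (n - i)"]
      by (auto simp: table_inv_def row_inv_def has_input_def start_row_def state_simps)
  qed (simp add: start_row_def)
next
  fix s assume start: "row_inv (n - i) 0 s"
  let ?m = "Suc (Suc n) - (n - i)"
  show "runs (Seq (While row_test row_step) next_row) s
    (Suc (Suc n) * (bcost row_test + ccost row_step + 1) + (bcost row_test + 1) + ccost next_row)
    (table_inv (Suc i))"
  proof (rule runs_Seq)
    show "runs (While row_test row_step) s
      (Suc (Suc n) * (bcost row_test + ccost row_step + 1) + (bcost row_test + 1))
      (row_inv (n - i) ?m)"
      by (rule runs_row[OF _ start]) simp
  next
    fix s assume s: "row_inv (n - i) ?m s"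
    have "row_ok (rarr s ''opt'') (iarr s ''nxt'') (n - i)"
      using s by (intro row_ok_if_partial) (auto simp: row_inv_def)
    moreover have "k = n - i \<or> n - i < k" if "n < k + Suc i" for k
      using that i by auto
    ultimately have "table_inv (Suc i) (outcome next_row s)"
      using s i by (auto simp: table_inv_def row_inv_def has_input_def next_row_def state_simps)
    then show "runs next_row s (ccost next_row) (table_inv (Suc i))"
      by (intro runs_loop_free) (auto simp: next_row_def)
  qed
qed

lemma runs_table:
  assumes "table_inv 0 s"
  shows "runs (While table_test table_step) s
    (Suc n * (bcost table_test + row_time n + 1) + (bcost table_test + 1)) (table_inv (Suc n))"
proof (rule runs_While)
  fix i s assume "i < Suc n" "table_inv i s"
  then show "bval s table_test \<and> runs table_step s (row_time n) (table_inv (Suc i))"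
    using runs_table_step by (auto simp: table_test_def table_inv_def has_input_def)
next
  fix s assume "table_inv (Suc n) s"
  then show "\<not> bval s table_test"
    by (auto simp: table_test_def table_inv_def has_input_def)
qed (rule assms)

text \<open>The table enters as parameters, so that facts established about it before the output
  loop still apply afterwards.\<close>

definition output_inv :: "(nat \<Rightarrow> nat) \<Rightarrow> (nat \<Rightarrow> real) \<Rightarrow> nat \<Rightarrow> state \<Rightarrow> bool" where
  "output_inv nxt g j s \<longleftrightarrow> has_input (v(Suc n := v n)) s \<and>
     iarr s ''nxt'' = nxt \<and> rarr s ''opt'' = g \<and>
     iarr s ''j'' 0 = Suc j \<and> iarr s ''k'' 0 = record_at nxt j \<and>
     (\<forall>i\<in>{1..j}. rarr s ''z'' i = capped a (v(Suc n := v n)) nxt i)"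

lemma output_inv_step:
  assumes "output_inv nxt g j s"
  shows "output_inv nxt g (Suc j) (outcome output_step s)"
proof -
  define w where "w = v(Suc n := v n)"
  have state: "iarr s ''n'' 0 = n" "rarr s ''a'' = a" "rarr s ''v'' = w" "rarr s ''b'' = b"
    "iarr s ''nxt'' = nxt" "rarr s ''opt'' = g"
    "iarr s ''j'' 0 = Suc j" "iarr s ''k'' 0 = record_at nxt j"
    "\<And>i. 1 \<le> i \<Longrightarrow> i \<le> j \<Longrightarrow> rarr s ''z'' i = capped a w nxt i"
    using assms by (auto simp: output_inv_def has_input_def w_def)
  then show ?thesis
    unfolding output_inv_def w_def[symmetric]
    by (auto simp: has_input_def output_step_def state_simps capped_def Let_def le_Suc_eq)
qed

lemma runs_output:
  assumes "output_inv nxt g 0 s"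
  shows "runs (While output_test output_step) s
    (n * (bcost output_test + ccost output_step + 1) + (bcost output_test + 1))
    (output_inv nxt g n)"
proof (rule runs_While[where I = "output_inv nxt g"])
  fix j s assume j: "j < n" and s: "output_inv nxt g j s"
  have "runs output_step s (ccost output_step) (output_inv nxt g (Suc j))"
    using output_inv_step[OF s] by (intro runs_loop_free) (auto simp: output_step_def)
  then show "bval s output_test \<and> runs output_step s (ccost output_step) (output_inv nxt g (Suc j))"
    using j s by (auto simp: output_test_def output_inv_def has_input_def)
next
  fix s assume "output_inv nxt g n s"
  then show "\<not> bval s output_test"
    by (auto simp: output_test_def output_inv_def has_input_def)
qed (rule assms)

lemma runs_program:
  assumes "table_inv 0 (outcome pad s)"
  shows "runs program s (program_time n) (solved n a v b)"
  unfolding program_def program_time_def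
proof (rule runs_Seq)
  show "runs pad s (ccost pad) (table_inv 0)"
    using assms by (intro runs_loop_free) (auto simp: pad_def)
next
  fix s assume s: "table_inv 0 s"
  show "runs (Seq (While table_test table_step) (Seq start_output (While output_test output_step))) s
    (Suc n * (bcost table_test + row_time n + 1) + (bcost table_test + 1) +
      (ccost start_output +
       (n * (bcost output_test + ccost output_step + 1) + (bcost output_test + 1))))
    (solved n a v b)"
  proof (rule runs_Seq[OF runs_table[OF s]])
    fix s assume s: "table_inv (Suc n) s"
    define g where "g = rarr s ''opt''"
    define nxt where "nxt = iarr s ''nxt''"
    interpret solved_table n a v b g nxt
      using s by unfold_locales (auto simp: table_inv_def g_def nxt_def)
    show "runs (Seq start_output (While output_test output_step)) s
      (ccost start_output +
       (n * (bcost output_test + ccost output_step + 1) + (bcost output_test + 1)))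
      (solved n a v b)"
    proof (rule runs_Seq)
      show "runs start_output s (ccost start_output) (output_inv nxt g 0)"
        using s by (intro runs_loop_free)
          (auto simp: start_output_def output_inv_def table_inv_def has_input_def state_simps
            g_def nxt_def)
    next
      fix s assume s: "output_inv nxt g 0 s"
      show "runs (While output_test output_step) s
        (n * (bcost output_test + ccost output_step + 1) + (bcost output_test + 1))
        (solved n a v b)"
      proof (rule runs_mono[OF runs_output[OF s] order_refl])
        fix s assume "output_inv nxt g n s"
        then have "rarr s ''opt'' = g" "\<And>j. j \<in> {1..n} \<Longrightarrow> rarr s ''z'' j = capped a u nxt j"
          by (auto simp: output_inv_def)
        then show "solved n a v b s"
          using optimal_if_capped[of "rarr s ''z''"] by (simp add: solved_def)
      qed
    qed
  qed
qed

end

text \<open>The padded instance is whatever memory holds after \<open>pad\<close>. It agrees with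
  the input on \<open>{1..n}\<close>, the only indices that feasibility and objective
  inspect.\<close>

lemma runs_program_init:
  assumes "valid_instance n a v b"
  shows "runs program (init_state n a v b) (program_time n) (solved n a v b)"
proof -
  define s where "s = outcome pad (init_state n a v b)"
  define a' where "a' = rarr s ''a''"
  define v' where "v' = rarr s ''v''"
  define b' where "b' = rarr s ''b''"
  note mem = s_def a'_def v'_def b'_def pad_def init_state_def state_simps
  have eq: "a' j = a j" "v' j = v j" "b' j = b j" if "j \<in> {1..n}" for j
    using that by (auto simp: mem)
  have "valid_instance n a' v' b'"
    using assms eq by (auto simp: valid_instance_def mono_on_def)
  then interpret padded_instance n a' v' b'
    by unfold_locales (auto simp: mem)
  have "iarr s ''n'' 0 = n" "iarr s ''i'' 0 = 0" "rarr s ''opt'' (Suc n) = 0"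
    by (simp_all add: mem)
  then have "table_inv 0 s"
    by (simp add: table_inv_def has_input_def a'_def[symmetric] v'_def[symmetric] b'_def[symmetric])
  then have "runs program (init_state n a v b) (program_time n) (solved n a' v' b')"
    by (intro runs_program) (simp add: s_def[symmetric])
  moreover have "feasible n a' = feasible n a"
    using eq by (simp add: feasible_def fun_eq_iff)
  moreover have "objective n v' b' = objective n v b"
    unfolding objective_def using eq by (intro ext sum.cong) auto
  ultimately show ?thesis by (simp add: solved_def[abs_def])
qed

theorem theorem13:
  "\<exists>(P :: com) (T :: nat \<Rightarrow> real).
     T \<in> O(\<lambda>n. (real n)\<^sup>2) \<and>
     (\<forall>(n :: nat) (a :: nat \<Rightarrow> real) (v :: nat \<Rightarrow> real) (b :: nat \<Rightarrow> real).
        valid_instance n a v b \<longrightarrow>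
        (\<exists>t s. exec P (init_state n a v b) t s \<and> real t \<le> T n \<and> solved n a v b s))"
proof -
  obtain C where C: "\<And>n. 1 \<le> n \<Longrightarrow> program_time n \<le> C * n\<^sup>2"
    using program_time_le by blast
  show ?thesis
  proof (intro exI[of _ program] exI[of _ "\<lambda>n. real C * (real n)\<^sup>2"] conjI allI impI)
    show "(\<lambda>n. real C * (real n)\<^sup>2) \<in> O(\<lambda>n. (real n)\<^sup>2)"
      by simp
  next
    fix n a v b assume valid: "valid_instance n a v b"
    then obtain t s where "exec program (init_state n a v b) t s" "t \<le> program_time n"
        "solved n a v b s"
      using runs_program_init[OF valid] by (auto simp: runs_def)
    \<comment> \<open>The bound requires \<open>n >= 1\<close>, which validity of the instance
      provides.\<close>
    moreover have "program_time n \<le> C * n\<^sup>2"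
      using C valid by (simp add: valid_instance_def)
    ultimately show "\<exists>t s. exec program (init_state n a v b) t s \<and>
        real t \<le> real C * (real n)\<^sup>2 \<and> solved n a v b s"
      by (metis of_nat_le_iff of_nat_mult of_nat_power order_trans)
  qed
qed

end
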